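(* Let $A\in\mathbb R^{m\times d}$ and consider the problem $\min_{x\in\mathcal X} f(x)$ with $\mathcal X=\{x\in\mathbb R^d: Ax\le b\}$ and $f(x)=g(x)+q^Tx$, where $g:\mathbb R^d\to\mathbb R$ is differentiable (and such that $f$ satisfies the standing smoothness assumption in the context). If the data vector $(q,b)\in\mathbb R^d\times\mathbb R^m$ is generated from a continuous measure, then with probability one the strict complementarity condition holds for the problem, i.e. every KKT pair $(x^*,\mu^* )$ of the problem satisfies strict complementarity.
   Context: $A_j$ is the $j$th row of $A$. A KKT pair is $(x^*,\mu^* )$ with $x^*\in\mathcal X$, $\mu^*\in\mathbb R^m$, $\mu^*\ge0$, $\nabla f(x^* )+\sum_{j=1}^m\mu_j^*A_j^T=0$ and $\mu^*_j(A_jx^*-b_j)=0$ for all $j$. It satisfies strict complementarity if for each $j\in[m]$ either $\mu_j^*>0$ and $A_jx^*=b_j$, or $\mu_j^*=0$ and $A_jx^*<b_j$. "Generated from a continuous measure" means that the law of $(q,b)$ is absolutely continuous with respect to Lebesgue measure on $\mathbb R^{d+m}$. Standing assumption: $f$ is twice differentiable with $\|\nabla f(x)-\nabla f(y)\|\le L_1\|x-y\|$ and $\|\nabla^2 f(x)-\nabla^2 f(y)\|\le L_2\|x-y\|$ for all $x,y\in\mathcal X$ (for each realization of $b$). *)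

theory Defs
  imports "HOL-Probability.Probability"
begin

(* The value is meaningful only where f is differentiable. *)
definition grad :: "('a::real_inner \<Rightarrow> real) \<Rightarrow> 'a \<Rightarrow> 'a" where
  "grad f x = (THE D. GDERIV f x :> D)"

abbreviation hessian :: "(real^'d \<Rightarrow> real) \<Rightarrow> real^'d \<Rightarrow> real^'d^'d" where
  "hessian f x \<equiv> jacobian (grad f) (at x)"

definition twice_differentiable_at :: "(real^'d \<Rightarrow> real) \<Rightarrow> real^'d \<Rightarrow> bool" where
  "twice_differentiable_at f x \<longleftrightarrow>
     (\<forall>\<^sub>F y in nhds x. f differentiable (at y)) \<and> grad f differentiable (at x)"

(* Matrices are measured in the spectral norm, i.e. the operator norm induced by the
   Euclidean norm; the type class norm on real^'d^'d is the Frobenius norm. *)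
definition smooth_on :: "(real^'d) set \<Rightarrow> real \<Rightarrow> real \<Rightarrow> (real^'d \<Rightarrow> real) \<Rightarrow> bool" where
  "smooth_on X L1 L2 f \<longleftrightarrow>
     (\<forall>x\<in>X. twice_differentiable_at f x) \<and>
     (\<forall>x\<in>X. \<forall>y\<in>X. norm (grad f x - grad f y) \<le> L1 * norm (x - y)) \<and>
     (\<forall>x\<in>X. \<forall>y\<in>X. onorm (\<lambda>v. (hessian f x - hessian f y) *v v) \<le> L2 * norm (x - y))"

(* The order on real^'m is componentwise. *)
definition feasible_set :: "real^'d^'m \<Rightarrow> real^'m \<Rightarrow> (real^'d) set" where
  "feasible_set A b = {x. A *v x \<le> b}"

definition KKT_pair ::
  "(real^'d \<Rightarrow> real) \<Rightarrow> real^'d^'m \<Rightarrow> real^'m \<Rightarrow> real^'d \<Rightarrow> real^'m \<Rightarrow> bool" where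
  "KKT_pair f A b x \<mu> \<longleftrightarrow>
     x \<in> feasible_set A b \<and> 0 \<le> \<mu> \<and>
     grad f x + (\<Sum>j\<in>UNIV. \<mu> $ j *\<^sub>R row j A) = 0 \<and>
     (\<forall>j. \<mu> $ j * (row j A \<bullet> x - b $ j) = 0)"

definition strictly_complementary ::
  "real^'d^'m \<Rightarrow> real^'m \<Rightarrow> real^'d \<Rightarrow> real^'m \<Rightarrow> bool" where
  "strictly_complementary A b x \<mu> \<longleftrightarrow>
     (\<forall>j. \<mu> $ j > 0 \<and> row j A \<bullet> x = b $ j \<or> \<mu> $ j = 0 \<and> row j A \<bullet> x < b $ j)"

definition strict_complementarity ::
  "(real^'d \<Rightarrow> real) \<Rightarrow> real^'d^'m \<Rightarrow> real^'m \<Rightarrow> bool" where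
  "strict_complementarity f A b \<longleftrightarrow>
     (\<forall>x \<mu>. KKT_pair f A b x \<mu> \<longrightarrow> strictly_complementary A b x \<mu>)"

end

(* A KKT pair violating strict complementarity at j with positive multipliers on S satisfies
   q = - grad g x - (\<Sum>i\<in>S. \<mu>_i A_i), b_i = A_i x for i \<in> S \<union> {j}, while the other
   entries of b are unconstrained. So (q, b) is determined by x, \<mu>_S and the remaining entries
   of b, which is one parameter less than the dimension of the data space. As grad g is
   differentiable at feasible points, the set of such data is Lebesgue null; no rank or
   constraint qualification is needed. A union over the finitely many (S, j) finishes the proof. *)
theory Submission
  imports Defs
begin

text \<open>\<open>grad\<close> is a definite description, so its value can be computed only once
  uniqueness is available.\<close>

lemma GDERIV_unique:
  assumes "GDERIV f x :> D" "GDERIV f x :> E"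
  shows "D = E"
proof -
  have "(\<lambda>h. h \<bullet> D) = (\<lambda>h. h \<bullet> E)"
    using assms has_derivative_unique unfolding gderiv_def by blast
  then show ?thesis
    by (meson vector_eq_ldot)
qed

lemma differentiable_imp_GDERIV_grad:
  fixes f :: "'a::euclidean_space \<Rightarrow> real"
  assumes "f differentiable (at x)"
  shows "GDERIV f x :> grad f x"
proof -
  obtain f' where f': "(f has_derivative f') (at x)"
    using assms by (auto simp: differentiable_def)
  then have "linear f'"
    by (rule has_derivative_linear)
  \<comment> \<open>The inner product of \<open>real\<close> is multiplication, so the adjoint at 1
    is the Riesz representer of the functional \<open>f'\<close>.\<close>
  then have "f' = (\<lambda>h. h \<bullet> adjoint f' 1)"
    by (auto simp: adjoint_works)
  then have "GDERIV f x :> adjoint f' 1"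
    using f' by (simp add: gderiv_def)
  then show ?thesis
    unfolding grad_def by (metis GDERIV_unique theI)
qed

lemma grad_add_inner:
  fixes g :: "'a::euclidean_space \<Rightarrow> real"
  assumes "g differentiable (at x)"
  shows "grad (\<lambda>x. g x + q \<bullet> x) x = grad g x + q"
proof -
  have "GDERIV (\<lambda>x. g x + q \<bullet> x) x :> grad g x + q"
    using differentiable_imp_GDERIV_grad[OF assms]
    by (auto simp: gderiv_def inner_add_right inner_commute intro!: derivative_eq_intros)
  then show ?thesis
    unfolding grad_def by (metis GDERIV_unique the_equality)
qed

(* On the null set v_j = 0, the parameter v_i stands for the multiplier \<mu>_i if i \<in> S
   and for b_i if i \<notin> S \<union> {j}. *)
definition degenerate_data ::
  "(real^'d \<Rightarrow> real^'d) \<Rightarrow> real^'d^'m \<Rightarrow> 'm set \<Rightarrow> 'm \<Rightarrow> (real^'d) \<times> (real^'m) \<Rightarrow> (real^'d) \<times> (real^'m)"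
  where "degenerate_data G A S j = (\<lambda>(x, v).
    (- G x - (\<Sum>i\<in>S. v $ i *\<^sub>R row i A), \<chi> i. if i \<in> insert j S then row i A \<bullet> x else v $ i))"

text \<open>The parameters lie in a hyperplane of a space of the same dimension as the data space,
  and a map differentiable at each point of a null set sends it to a null set when the dimension
  does not drop. Apart from \<open>G\<close>, the map is linear in (x, v).\<close>

lemma negligible_degenerate_data:
  fixes G :: "real^'d \<Rightarrow> real^'d" and A :: "real^'d^'m"
  shows "negligible (degenerate_data G A S j ` {(x, v). G differentiable (at x) \<and> v $ j = 0})"
    (is "negligible (_ ` ?D)")
proof (rule negligible_differentiable_image_negligible)
  have "?D \<subseteq> {z. (0, axis j 1) \<bullet> z = 0}"
    by (auto simp: inner_axis inner_commute)
  moreover have "negligible {z. (0 :: real^'d, axis j 1 :: real^'m) \<bullet> z = 0}"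
    by (rule negligible_hyperplane) (simp add: zero_prod_def axis_eq_0_iff)
  ultimately show "negligible ?D"
    by (rule negligible_subset[rotated])
  show "degenerate_data G A S j differentiable_on ?D"
  proof (rule differentiable_at_imp_differentiable_on)
    fix z assume z: "z \<in> ?D"
    define p :: "(real^'d) \<times> (real^'m) \<Rightarrow> real^'d" where
      "p z = - (\<Sum>i\<in>S. snd z $ i *\<^sub>R row i A)" for z
    define r :: "(real^'d) \<times> (real^'m) \<Rightarrow> real^'m" where
      "r z = (\<chi> i. if i \<in> insert j S then row i A \<bullet> fst z else snd z $ i)" for z
    have "linear p"
      by (rule linearI) (simp_all add: p_def sum.distrib algebra_simps scaleR_sum_right)
    have "linear r"
      by (rule linearI) (simp_all add: r_def vec_eq_iff algebra_simps)
    have G: "G differentiable (at (fst z))"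
      using z by auto
    have "(G \<circ> fst) differentiable (at z)"
      by (rule differentiable_chain_at)
        (use G in \<open>auto intro: bounded_linear_imp_differentiable bounded_linear_fst\<close>)
    then have "(\<lambda>z. (p z - G (fst z), r z)) differentiable (at z)"
      using linear_imp_differentiable[OF \<open>linear p\<close>] linear_imp_differentiable[OF \<open>linear r\<close>]
      by (auto simp: o_def intro!: differentiable_Pair differentiable_diff)
    moreover have "degenerate_data G A S j = (\<lambda>z. (p z - G (fst z), r z))"
      unfolding degenerate_data_def p_def r_def by (rule ext) (simp add: case_prod_beta)
    ultimately show "degenerate_data G A S j differentiable (at z)"
      by simp
  qed
qed simp

lemma KKT_pair_degenerate_data:
  fixes A :: "real^'d^'m"
  assumes "KKT_pair f A b x \<mu>" "\<not> strictly_complementary A b x \<mu>"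
    and grad: "grad f x = G x + q" and diff: "G differentiable (at x)"
  shows "\<exists>S j. (q, b) \<in> degenerate_data G A S j ` {(x, v). G differentiable (at x) \<and> v $ j = 0}"
proof -
  have feas: "row i A \<bullet> x \<le> b $ i" and nonneg: "0 \<le> \<mu> $ i"
    and compl: "\<mu> $ i = 0 \<or> row i A \<bullet> x = b $ i" for i
    using assms(1) by (auto simp: KKT_pair_def feasible_set_def less_eq_vec_def
        matrix_vector_mul_component row_def vec_lambda_eta)
  have stat: "G x + q + (\<Sum>i\<in>UNIV. \<mu> $ i *\<^sub>R row i A) = 0"
    using assms(1) grad by (auto simp: KKT_pair_def)
  \<comment> \<open>Feasibility, nonnegativity and complementarity leave only one way to fail: an
    active constraint with zero multiplier.\<close>
  obtain j where j: "\<mu> $ j = 0" "row j A \<bullet> x = b $ j"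
    using assms(2) feas nonneg compl unfolding strictly_complementary_def
    by (metis order_le_less)
  define S where "S = {i. \<mu> $ i \<noteq> 0}"
  \<comment> \<open>Since \<mu>_j = 0, j lies outside \<open>S\<close>, and the slot j is free to be
    0: b_j is recovered as A_j x.\<close>
  define v where "v = (\<chi> i. if i \<in> S then \<mu> $ i else if i = j then 0 else b $ i)"
  have "(\<Sum>i\<in>S. v $ i *\<^sub>R row i A) = (\<Sum>i\<in>UNIV. \<mu> $ i *\<^sub>R row i A)"
    by (rule sum.mono_neutral_cong_left) (auto simp: S_def v_def)
  then have "q = - G x - (\<Sum>i\<in>S. v $ i *\<^sub>R row i A)"
    using stat by (simp add: algebra_simps eq_neg_iff_add_eq_0)
  moreover have "b $ i = (if i \<in> insert j S then row i A \<bullet> x else v $ i)" for i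
    using j(2) compl[of i] by (auto simp: v_def S_def)
  then have "b = (\<chi> i. if i \<in> insert j S then row i A \<bullet> x else v $ i)"
    by (simp add: vec_eq_iff)
  ultimately have "(q, b) = degenerate_data G A S j (x, v)"
    by (simp add: degenerate_data_def)
  moreover have "v $ j = 0"
    using j by (simp add: v_def S_def)
  ultimately show ?thesis
    using diff by blast
qed

text \<open>Absolute continuity speaks of Borel null sets, while \<open>N\<close> may fail to be
  Borel; hence the passage to a Borel null set \<open>N'\<close> containing it.\<close>

lemma AE_not_mem_negligible:
  fixes X :: "'w \<Rightarrow> 'a::euclidean_space"
  assumes X: "X \<in> borel_measurable M"
    and ac: "absolutely_continuous lborel (distr M borel X)"
    and N: "negligible N"
  shows "AE \<omega> in M. X \<omega> \<notin> N"
proof -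
  obtain N' where N': "N' \<in> null_sets lborel" "N \<subseteq> N'"
    using N by (auto simp: negligible_iff_null_sets null_sets_completion_iff2)
  then have "N' \<in> null_sets (distr M borel X)"
    using ac by (auto simp: absolutely_continuous_def)
  then have "AE y in distr M borel X. y \<notin> N'"
    by (rule AE_not_in)
  then have "AE \<omega> in M. X \<omega> \<notin> N'"
    by (rule AE_distrD[OF X])
  then show ?thesis
    using N'(2) by auto
qed

theorem corollary1:
  fixes M :: "'w measure"
    and A :: "real^'d^'m"
    and g :: "real^'d \<Rightarrow> real"
    and q :: "'w \<Rightarrow> real^'d"
    and b :: "'w \<Rightarrow> real^'m"
    and f :: "'w \<Rightarrow> real^'d \<Rightarrow> real"
  assumes "prob_space M"
    and "(\<lambda>\<omega>. (q \<omega>, b \<omega>)) \<in> borel_measurable M"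
    and "absolutely_continuous lborel (distr M borel (\<lambda>\<omega>. (q \<omega>, b \<omega>)))"
    and "\<And>x. g differentiable (at x)"
    and "\<And>\<omega> x. f \<omega> x = g x + q \<omega> \<bullet> x"
    and "\<And>\<omega>. \<omega> \<in> space M \<Longrightarrow> \<exists>L1 L2. smooth_on (feasible_set A (b \<omega>)) L1 L2 (f \<omega>)"
  shows "AE \<omega> in M. strict_complementarity (f \<omega>) A (b \<omega>)"
proof -
  \<comment> \<open>Built from \<open>grad g\<close> instead of the gradient of
    \<open>f \<omega>\<close>, these sets do not depend on \<omega>, so one null set serves all
    realizations.\<close>
  define E where "E S j = degenerate_data (grad g) A S j `
    {(x, v). grad g differentiable (at x) \<and> v $ j = 0}" for S j
  define N where "N = (\<Union>S j. E S j)"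
  have E: "negligible (E S j)" for S j
    unfolding E_def by (rule negligible_degenerate_data)
  have "negligible (\<Union>j. E S j)" for S
    by (rule negligible_Union) (auto simp: E)
  then have "negligible N"
    unfolding N_def by (intro negligible_Union) auto
  then have "AE \<omega> in M. (q \<omega>, b \<omega>) \<notin> N"
    by (rule AE_not_mem_negligible[OF assms(2,3)])
  then show ?thesis
  proof (rule AE_mp, intro AE_I2 impI)
    fix \<omega> assume \<omega>: "\<omega> \<in> space M" "(q \<omega>, b \<omega>) \<notin> N"
    have "f \<omega> = (\<lambda>x. g x + q \<omega> \<bullet> x)"
      by (rule ext) (rule assms(5))
    then have grad: "grad (f \<omega>) = (\<lambda>x. grad g x + q \<omega>)"
      by (simp only: grad_add_inner[OF assms(4), abs_def])
    show "strict_complementarity (f \<omega>) A (b \<omega>)"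
      unfolding strict_complementarity_def
    proof (intro allI impI, rule ccontr)
      fix x \<mu>
      assume *: "KKT_pair (f \<omega>) A (b \<omega>) x \<mu>" "\<not> strictly_complementary A (b \<omega>) x \<mu>"
      then have "x \<in> feasible_set A (b \<omega>)"
        by (simp add: KKT_pair_def)
      \<comment> \<open>Second-order smoothness is assumed of \<open>f \<omega>\<close> at feasible
        points; it passes to \<open>grad g\<close> there because the two gradients differ by the
        constant \<open>q \<omega>\<close>.\<close>
      then have "grad (f \<omega>) differentiable (at x)"
        using assms(6)[OF \<omega>(1)] by (auto simp: smooth_on_def twice_differentiable_at_def)
      then have "(\<lambda>x. grad (f \<omega>) x - q \<omega>) differentiable (at x)"
        by (intro differentiable_diff) simp_all
      then have "grad g differentiable (at x)"
        by (simp add: grad)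
      then have "(q \<omega>, b \<omega>) \<in> N"
        using KKT_pair_degenerate_data[OF *, of "grad g" "q \<omega>"] unfolding N_def E_def grad by blast
      then show False
        using \<omega>(2) by contradiction
    qed
  qed
qed

end
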